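(* Let $\mathcal{H} = \mathcal{H}_{\mathfrak l}\otimes\mathcal{H}_{\mathfrak w}\otimes\mathcal{H}_{\mathfrak e}$ be a finite-dimensional tripartite Hilbert space and let the Hamiltonian (a Hermitian operator on $\mathcal H$) have the form $$H = H_{\mathfrak l} + H_{\mathfrak w} + H_{\mathfrak e} + H_{\mathfrak{lw}} + H_{\mathfrak{we}},$$ where $H_{\mathfrak l} = H_L\otimes \mathbb{1}_{\mathfrak w}\otimes \mathbb{1}_{\mathfrak e}$, $H_{\mathfrak w} = \mathbb{1}_{\mathfrak l}\otimes H_W\otimes \mathbb{1}_{\mathfrak e}$, $H_{\mathfrak e} = \mathbb{1}_{\mathfrak l}\otimes \mathbb{1}_{\mathfrak w}\otimes H_E$, $H_{\mathfrak{lw}} = \sum_j B_j\otimes C_j\otimes \mathbb{1}_{\mathfrak e}$ and $H_{\mathfrak{we}} = \sum_j \mathbb{1}_{\mathfrak l}\otimes D_j\otimes E_j$ (finite sums), with all of $H_L, H_W, H_E, B_j, C_j, D_j, E_j$ Hermitian. If there exists such a representation of $H$ for which all of the operators $H_W$, $C_j$ and $D_j$ (for all $j$) share a common eigenstate $|w\rangle\in\mathcal{H}_{\mathfrak w}$, then $|w\rangle$ is a perfect wall state.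
   Context: Perfect wall state: let $\mathcal{H} = \mathcal{H}_{\mathfrak l}\otimes\mathcal{H}_{\mathfrak w}\otimes\mathcal{H}_{\mathfrak e}$ (logical, wall and environment subsystems) with Hamiltonian $H$. A unit vector $|w\rangle\in\mathcal{H}_{\mathfrak w}$ is a perfect wall state if, for factorized initial states $\rho_0 = \rho_{\mathfrak l}\otimes|w\rangle\langle w|\otimes\rho_{\mathfrak e}$, the reduced dynamics on the logical subsystem $$\rho_{\mathfrak l}(t) = \mathrm{tr}_{\mathfrak{we}}\big(e^{-\mathrm{i}Ht}\rho_0 e^{\mathrm{i}Ht}\big)$$ are unitary for all initial density matrices $\rho_{\mathfrak l}$ on $\mathcal{H}_{\mathfrak l}$ and $\rho_{\mathfrak e}$ on $\mathcal{H}_{\mathfrak e}$; that is, for every $\rho_{\mathfrak e}$ there is a family of unitaries $U_{\mathfrak l}(t)$ on $\mathcal{H}_{\mathfrak l}$ such that $\rho_{\mathfrak l}(t) = U_{\mathfrak l}(t)\rho_{\mathfrak l}U_{\mathfrak l}(t)^\dagger$ for all $t$ and all $\rho_{\mathfrak l}$. Here $\mathrm{tr}_{\mathfrak{we}}$ is the partial trace over $\mathcal{H}_{\mathfrak w}\otimes\mathcal{H}_{\mathfrak e}$. *)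

theory Defs
  imports "HOL-Analysis.Analysis"
begin

text \<open>
  A finite-dimensional Hilbert space is represented as \<open>complex ^ 'n\<close> for a finite index type \<open>'n\<close>,
  and operators on it as square matrices. A tensor product of spaces is indexed by the product of
  the index types, so the logical-wall-environment space is \<open>complex ^ ('l \<times> 'w \<times> 'e)\<close>.
\<close>

type_synonym 'n cmat = "complex ^ 'n ^ 'n"

definition tensor_op :: "'m::finite cmat \<Rightarrow> 'n::finite cmat \<Rightarrow> ('m \<times> 'n) cmat"  (infixr \<open>\<otimes>\<close> 75)
  where "A \<otimes> B = (\<chi> i j. A $ fst i $ fst j * B $ snd i $ snd j)"

definition dagger :: "'n::finite cmat \<Rightarrow> 'n cmat"
  where "dagger A = (\<chi> i j. cnj (A $ j $ i))"

definition hermitian :: "'n::finite cmat \<Rightarrow> bool"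
  where "hermitian A \<longleftrightarrow> dagger A = A"

definition unitary :: "'n::finite cmat \<Rightarrow> bool"
  where "unitary U \<longleftrightarrow> dagger U ** U = mat 1 \<and> U ** dagger U = mat 1"

definition cscale :: "complex \<Rightarrow> 'n::finite cmat \<Rightarrow> 'n cmat"
  where "cscale c A = (\<chi> i j. c * A $ i $ j)"

text \<open>
  The library operations \<open>*\<close> and \<open>^\<close> on \<open>complex ^ 'n ^ 'n\<close> act componentwise, so powers with
  respect to the matrix product \<open>**\<close> and the exponential series are defined here.
\<close>

primrec mat_pow :: "'n::finite cmat \<Rightarrow> nat \<Rightarrow> 'n cmat"
  where
    "mat_pow A 0 = mat 1"
  | "mat_pow A (Suc k) = A ** mat_pow A k"

definition mat_exp :: "'n::finite cmat \<Rightarrow> 'n cmat"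
  where "mat_exp A = (\<Sum>k. mat_pow A k /\<^sub>R fact k)"

definition inner_prod :: "complex ^ 'n::finite \<Rightarrow> complex ^ 'n \<Rightarrow> complex"
  where "inner_prod u v = (\<Sum>i\<in>UNIV. cnj (u $ i) * v $ i)"

text \<open>For Hermitian \<open>A\<close> the quadratic form is real, so comparing its real part with 0 suffices.\<close>

definition positive_semidefinite :: "'n::finite cmat \<Rightarrow> bool"
  where "positive_semidefinite A \<longleftrightarrow> hermitian A \<and> (\<forall>v. 0 \<le> Re (inner_prod v (A *v v)))"

definition density_matrix :: "'n::finite cmat \<Rightarrow> bool"
  where "density_matrix \<rho> \<longleftrightarrow> positive_semidefinite \<rho> \<and> trace \<rho> = 1"

text \<open>The operator \<open>|w\<rangle>\<langle>w|\<close>.\<close>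

definition ketbra :: "complex ^ 'n::finite \<Rightarrow> 'n cmat"
  where "ketbra w = (\<chi> i j. w $ i * cnj (w $ j))"

definition partial_trace_snd :: "('m::finite \<times> 'n::finite) cmat \<Rightarrow> 'm cmat"
  where "partial_trace_snd X = (\<chi> i j. \<Sum>k\<in>UNIV. X $ (i, k) $ (j, k))"

text \<open>States are unit vectors; \<open>norm\<close> on \<open>complex ^ 'n\<close> is the Hilbert-space norm.\<close>

definition eigenstate :: "'n::finite cmat \<Rightarrow> complex ^ 'n \<Rightarrow> bool"
  where "eigenstate A w \<longleftrightarrow> norm w = 1 \<and> (\<exists>c. A *v w = c *s w)"

text \<open>
  Products of index types associate to the right, so tracing out the second factor of
  \<open>'l \<times> ('w \<times> 'e)\<close> is the partial trace over wall and environment.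
\<close>

definition reduced_state ::
  "('l::finite \<times> 'w::finite \<times> 'e::finite) cmat \<Rightarrow> complex ^ 'w \<Rightarrow> 'e cmat \<Rightarrow> 'l cmat \<Rightarrow> real \<Rightarrow> 'l cmat"
  where "reduced_state H w \<rho>e \<rho>l t =
    partial_trace_snd
      (mat_exp (cscale (- \<i> * of_real t) H) ** (\<rho>l \<otimes> ketbra w \<otimes> \<rho>e) **
       mat_exp (cscale (\<i> * of_real t) H))"

definition perfect_wall_state ::
  "('l::finite \<times> 'w::finite \<times> 'e::finite) cmat \<Rightarrow> complex ^ 'w \<Rightarrow> bool"
  where "perfect_wall_state H w \<longleftrightarrow>
    norm w = 1 \<and>
    (\<forall>\<rho>e. density_matrix \<rho>e \<longrightarrow>
      (\<exists>U :: real \<Rightarrow> 'l cmat.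
        (\<forall>t. unitary (U t)) \<and>
        (\<forall>t \<rho>l. density_matrix \<rho>l \<longrightarrow>
          reduced_state H w \<rho>e \<rho>l t = U t ** \<rho>l ** dagger (U t))))"

end

theory Submission
  imports Defs
begin

text \<open>
  Put \<open>P = 1 \<otimes> |w\<rangle>\<langle>w| \<otimes> 1\<close>. Replacing every wall operator by its (real) eigenvalue turns \<open>H\<close> into
  \<open>G = A \<otimes> 1 \<otimes> 1 + 1 \<otimes> 1 \<otimes> F\<close> with Hermitian \<open>A\<close> and \<open>F\<close>, and \<open>H P = G P\<close>. As \<open>G\<close> commutes with \<open>P\<close>,
  this lifts to \<open>exp (s H) P = exp (s G) P\<close>, and \<open>exp (s G) = exp (s A) \<otimes> 1 \<otimes> exp (s F)\<close>.
  Since the initial state is fixed by \<open>P\<close> on both sides, logical subsystem and environment evolve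
  independently, by \<open>exp (-\<i> t A)\<close> and \<open>exp (-\<i> t F)\<close>.
\<close>

subsection \<open>Matrix algebra\<close>

lemma cscale_zero [simp]: "cscale 0 A = 0"
  by (simp add: cscale_def vec_eq_iff)

lemma cscale_one [simp]: "cscale 1 A = A"
  by (simp add: cscale_def vec_eq_iff)

lemma cscale_cscale [simp]: "cscale a (cscale b A) = cscale (a * b) A"
  by (simp add: cscale_def vec_eq_iff)

lemma cscale_add_left: "cscale (a + b) A = cscale a A + cscale b A"
  by (simp add: cscale_def vec_eq_iff algebra_simps)

lemma cscale_add: "cscale c (A + B) = cscale c A + cscale c B"
  by (simp add: cscale_def vec_eq_iff algebra_simps)

lemma cscale_mult_left: "cscale c A ** B = cscale c (A ** B)"
  by (simp add: cscale_def vec_eq_iff matrix_matrix_mult_def sum_distrib_left mult.assoc)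

lemma cscale_mult_right: "A ** cscale c B = cscale c (A ** B)"
  by (simp add: cscale_def vec_eq_iff matrix_matrix_mult_def sum_distrib_left mult.left_commute)

text \<open>Linearity here is over the reals. This is enough, since the exponential series is scaled
  by real factors, and it lets finite sums and limits pass through a matrix product.\<close>

lemma linear_mult_left: "linear (\<lambda>X. A ** X)" for A :: "'n::finite cmat"
  by (rule linearI) (simp_all add: vec_eq_iff matrix_matrix_mult_def scaleR_sum_right
      sum.distrib algebra_simps)

lemma linear_mult_right: "linear (\<lambda>X. X ** A)" for A :: "'n::finite cmat"
  by (rule linearI) (simp_all add: vec_eq_iff matrix_matrix_mult_def scaleR_sum_right
      sum.distrib algebra_simps)

lemma dagger_add: "dagger (A + B) = dagger A + dagger B"
  by (simp add: dagger_def vec_eq_iff)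

lemma dagger_mult: "dagger (A ** B) = dagger B ** dagger A"
  by (simp add: dagger_def vec_eq_iff matrix_matrix_mult_def mult.commute)

lemma dagger_cscale: "dagger (cscale c A) = cscale (cnj c) (dagger A)"
  by (simp add: dagger_def cscale_def vec_eq_iff)

lemma dagger_mat_1 [simp]: "dagger (mat 1) = mat 1"
  by (auto simp: dagger_def mat_def vec_eq_iff)

lemma linear_dagger: "linear dagger"
  by (rule linearI) (simp_all add: dagger_def vec_eq_iff)

lemma hermitian_mat_1: "hermitian (mat 1)"
  by (simp add: hermitian_def)

lemma hermitian_add: "hermitian A \<Longrightarrow> hermitian B \<Longrightarrow> hermitian (A + B)"
  by (simp add: hermitian_def dagger_add)

lemma hermitian_cscale_real: "c \<in> \<real> \<Longrightarrow> hermitian A \<Longrightarrow> hermitian (cscale c A)"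
  by (simp add: hermitian_def dagger_cscale Reals_cnj_iff)

lemma hermitian_sum: "(\<And>i. i \<in> I \<Longrightarrow> hermitian (f i)) \<Longrightarrow> hermitian (\<Sum>i\<in>I. f i)"
  by (simp add: hermitian_def linear_sum[OF linear_dagger])

subsection \<open>Tensor products\<close>

lemma tensor_op_mult: "(A \<otimes> B) ** (C \<otimes> D) = (A ** C) \<otimes> (B ** D)"
proof -
  have "(\<Sum>k\<in>UNIV. (A $ fst i $ fst k * B $ snd i $ snd k) * (C $ fst k $ fst j * D $ snd k $ snd j))
      = (\<Sum>a\<in>UNIV. A $ fst i $ a * C $ a $ fst j) * (\<Sum>b\<in>UNIV. B $ snd i $ b * D $ b $ snd j)"
    for i j
    unfolding sum_product sum.cartesian_product UNIV_Times_UNIV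
    by (rule sum.cong) (auto simp: mult_ac)
  then show ?thesis
    by (simp add: tensor_op_def vec_eq_iff matrix_matrix_mult_def)
qed

lemma tensor_op_mat_1 [simp]: "mat 1 \<otimes> mat 1 = mat 1"
  by (auto simp: tensor_op_def mat_def vec_eq_iff)

lemma tensor_op_add_left: "(A + B) \<otimes> C = A \<otimes> C + B \<otimes> C"
  by (simp add: tensor_op_def vec_eq_iff algebra_simps)

lemma tensor_op_add_right: "A \<otimes> (B + C) = A \<otimes> B + A \<otimes> C"
  by (simp add: tensor_op_def vec_eq_iff algebra_simps)

lemma linear_tensor_op_left: "linear (\<lambda>X. X \<otimes> A)"
  by (rule linearI) (simp_all add: tensor_op_def vec_eq_iff algebra_simps)

lemma linear_tensor_op_right: "linear (\<lambda>X. A \<otimes> X)"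
  by (rule linearI) (simp_all add: tensor_op_def vec_eq_iff algebra_simps)

lemma cscale_tensor_op_left: "cscale c A \<otimes> B = cscale c (A \<otimes> B)"
  by (simp add: tensor_op_def cscale_def vec_eq_iff algebra_simps)

lemma cscale_tensor_op_right: "A \<otimes> cscale c B = cscale c (A \<otimes> B)"
  by (simp add: tensor_op_def cscale_def vec_eq_iff algebra_simps)

lemma dagger_tensor_op: "dagger (A \<otimes> B) = dagger A \<otimes> dagger B"
  by (simp add: tensor_op_def dagger_def vec_eq_iff)

lemma hermitian_tensor_op: "hermitian A \<Longrightarrow> hermitian B \<Longrightarrow> hermitian (A \<otimes> B)"
  by (simp add: hermitian_def dagger_tensor_op)

lemma trace_tensor_op: "trace (A \<otimes> B) = trace A * trace B"
  unfolding trace_def tensor_op_def sum_product sum.cartesian_product UNIV_Times_UNIV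
  by (rule sum.cong) auto

lemma partial_trace_snd_tensor_op: "partial_trace_snd (A \<otimes> B) = cscale (trace B) A"
  by (simp add: partial_trace_snd_def tensor_op_def cscale_def trace_def vec_eq_iff
      sum_distrib_left mult.commute)

subsection \<open>The matrix exponential\<close>

text \<open>The sum of all entry norms is a crude bound, but it dominates every row sum, so each
  multiplication by \<open>A\<close> costs at most one more factor of it. The row \<open>i\<close>
  must vary in the induction because the product runs through all rows of the previous
  power.\<close>

lemma mat_pow_entry_bound:
  fixes A :: "'n::finite cmat"
  shows "norm (mat_pow A k $ i $ j) \<le> (\<Sum>a\<in>UNIV. \<Sum>b\<in>UNIV. norm (A $ a $ b)) ^ k"
proof (induction k arbitrary: i)
  case 0
  then show ?case by (simp add: mat_def)
next
  case (Suc k)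
  define c where "c = (\<Sum>a\<in>UNIV. \<Sum>b\<in>UNIV. norm (A $ a $ b))"
  have c: "0 \<le> c"
    by (simp add: c_def sum_nonneg)
  have row: "(\<Sum>b\<in>UNIV. norm (A $ i $ b)) \<le> c"
    unfolding c_def by (rule member_le_sum) (auto simp: sum_nonneg)
  have "norm (mat_pow A (Suc k) $ i $ j) \<le> (\<Sum>b\<in>UNIV. norm (A $ i $ b) * norm (mat_pow A k $ b $ j))"
    by (simp add: matrix_matrix_mult_def norm_mult flip: norm_mult) (rule norm_sum)
  also have "\<dots> \<le> (\<Sum>b\<in>UNIV. norm (A $ i $ b) * c ^ k)"
    using Suc.IH by (intro sum_mono mult_left_mono) (auto simp: c_def)
  also have "\<dots> \<le> c * c ^ k"
    unfolding sum_distrib_right[symmetric] using row c by (intro mult_right_mono) auto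
  finally show ?case
    by (simp add: c_def)
qed

text \<open>Comparison with the real exponential series. Absolute convergence is stated because the
  Cauchy product of two such series is taken later.\<close>

lemma summable_norm_mat_exp_entry:
  fixes A :: "'n::finite cmat"
  shows "summable (\<lambda>k. norm ((mat_pow A k /\<^sub>R fact k) $ i $ j))"
proof (rule summable_comparison_test')
  let ?c = "\<Sum>a\<in>UNIV. \<Sum>b\<in>UNIV. norm (A $ a $ b)"
  show "summable (\<lambda>k. inverse (fact k) * ?c ^ k)"
    by (rule summable_exp)
  show "norm (norm ((mat_pow A k /\<^sub>R fact k) $ i $ j)) \<le> inverse (fact k) * ?c ^ k" for k
    using mult_left_mono[OF mat_pow_entry_bound[of A k i j], of "inverse (fact k)"] by simp
qed

lemma mat_exp_sums: "(\<lambda>k. mat_pow A k /\<^sub>R fact k) sums mat_exp A"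
proof -
  have "(\<lambda>k. (mat_pow A k /\<^sub>R fact k) $ i $ j) sums (\<Sum>k. (mat_pow A k /\<^sub>R fact k) $ i $ j)" for i j
    using summable_norm_cancel[OF summable_norm_mat_exp_entry] by (rule summable_sums)
  then have "(\<lambda>k. mat_pow A k /\<^sub>R fact k) sums (\<chi> i j. \<Sum>k. (mat_pow A k /\<^sub>R fact k) $ i $ j)"
    unfolding sums_def by (intro vec_tendstoI) (simp add: sum_component)
  then show ?thesis
    unfolding mat_exp_def by (simp add: sums_iff)
qed

lemma mat_exp_entry_sums: "(\<lambda>k. (mat_pow A k /\<^sub>R fact k) $ i $ j) sums (mat_exp A $ i $ j)"
  using bounded_linear.sums[OF bounded_linear_vec_nth
      bounded_linear.sums[OF bounded_linear_vec_nth mat_exp_sums]] .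

text \<open>Linear maps between finite-dimensional spaces are bounded and so commute with the
  exponential series. Any identity that relates powers through linear maps therefore lifts to
  exponentials; adjoints, tensor factors and multiplication by a projection are all handled this
  way.\<close>

lemma mat_exp_linear_eq:
  fixes f :: "'m::finite cmat \<Rightarrow> 'k::finite cmat" and g :: "'n::finite cmat \<Rightarrow> 'k cmat"
  assumes "linear f" "linear g" and eq: "\<And>k. f (mat_pow A k) = g (mat_pow B k)"
  shows "f (mat_exp A) = g (mat_exp B)"
proof (rule sums_unique2)
  have bl: "bounded_linear f" "bounded_linear g"
    using assms by (auto simp: linear_conv_bounded_linear)
  show "(\<lambda>k. f (mat_pow A k /\<^sub>R fact k)) sums f (mat_exp A)"
    by (rule bounded_linear.sums[OF bl(1) mat_exp_sums])
  show "(\<lambda>k. f (mat_pow A k /\<^sub>R fact k)) sums g (mat_exp B)"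
    using bounded_linear.sums[OF bl(2) mat_exp_sums[of B]]
    by (simp add: linear_scale[OF assms(1)] linear_scale[OF assms(2)] eq)
qed

lemma mat_pow_commute:
  assumes "A ** B = B ** A"
  shows "mat_pow A k ** B = B ** mat_pow A k"
proof (induction k)
  case (Suc k)
  then show ?case
    by (simp add: matrix_mul_assoc flip: assms) (simp flip: matrix_mul_assoc)
qed simp

lemma dagger_mat_exp: "dagger (mat_exp A) = mat_exp (dagger A)"
proof (rule mat_exp_linear_eq[where g = "\<lambda>X. X"])
  show "dagger (mat_pow A k) = mat_pow (dagger A) k" for k
    by (induction k) (simp_all add: dagger_mult mat_pow_commute)
qed (simp_all add: linear_dagger linear_id[unfolded id_def])

lemma mat_exp_tensor_op_mat_1: "mat_exp (A \<otimes> mat 1) = mat_exp A \<otimes> mat 1"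
proof (rule mat_exp_linear_eq[where f = "\<lambda>X. X"])
  show "mat_pow (A \<otimes> mat 1) k = mat_pow A k \<otimes> mat 1" for k
    by (induction k) (simp_all add: tensor_op_mult)
qed (simp_all add: linear_tensor_op_left linear_id[unfolded id_def])

lemma mat_exp_mat_1_tensor_op: "mat_exp (mat 1 \<otimes> A) = mat 1 \<otimes> mat_exp A"
proof (rule mat_exp_linear_eq[where f = "\<lambda>X. X"])
  show "mat_pow (mat 1 \<otimes> A) k = mat 1 \<otimes> mat_pow A k" for k
    by (induction k) (simp_all add: tensor_op_mult)
qed (simp_all add: linear_tensor_op_right linear_id[unfolded id_def])

text \<open>\<open>A\<close> and \<open>B\<close> agree on the range of \<open>P\<close>, and that
  range is invariant under \<open>B\<close> because \<open>B\<close> commutes with \<open>P\<close>.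
  Hence all powers agree there as well: each step moves \<open>P\<close> to the left, next to the
  new factor \<open>A\<close>, and exchanges \<open>A\<close> for \<open>B\<close>.\<close>

lemma mat_exp_mult_eq:
  assumes eq: "A ** P = B ** P" and comm: "B ** P = P ** B"
  shows "mat_exp A ** P = mat_exp B ** P"
proof (rule mat_exp_linear_eq)
  show "mat_pow A k ** P = mat_pow B k ** P" for k
  proof (induction k)
    case (Suc k)
    have "mat_pow A (Suc k) ** P = A ** (P ** mat_pow B k)"
      using Suc mat_pow_commute[OF comm] by (simp flip: matrix_mul_assoc)
    also have "\<dots> = B ** (P ** mat_pow B k)"
      by (simp add: matrix_mul_assoc eq)
    finally show ?case
      by (simp add: mat_pow_commute[OF comm] flip: matrix_mul_assoc)
  qed simp
qed (rule linear_mult_right)+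

section \<open>The exponential law for commuting matrices\<close>

lemma mat_exp_zero: "mat_exp 0 = mat 1"
proof -
  have "mat_pow (0 :: 'a cmat) k /\<^sub>R fact k = (if k = 0 then mat 1 else 0)" for k
    by (cases k) simp_all
  then have "(\<lambda>k. if k = 0 then mat 1 else 0) sums mat_exp (0 :: 'a cmat)"
    using mat_exp_sums[of "0 :: 'a cmat"] by simp
  then show ?thesis
    using sums_single[of 0 "\<lambda>_. mat 1 :: 'a cmat"] sums_unique2 by fastforce
qed

text \<open>The binomial theorem for commuting matrices, divided by \<open>fact n\<close> so that
  the right-hand side is the n-th term of a Cauchy product.\<close>

lemma mat_pow_add_commuting:
  assumes comm: "A ** B = B ** A"
  shows "mat_pow (A + B) n /\<^sub>R fact n =
    (\<Sum>k\<le>n. (mat_pow A k /\<^sub>R fact k) ** (mat_pow B (n - k) /\<^sub>R fact (n - k)))"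
proof -
  note [simp] = linear_scale[OF linear_mult_left] linear_scale[OF linear_mult_right]
  have "mat_pow (A + B) n = (\<Sum>k\<le>n. real (n choose k) *\<^sub>R (mat_pow A k ** mat_pow B (n - k)))"
  proof (induction n)
    case (Suc n)
    let ?t = "\<lambda>m k. mat_pow A k ** mat_pow B (m - k)"
    have B: "B ** mat_pow A k ** mat_pow B (n - k) = ?t (Suc n) k" if "k \<le> n" for k
      using mat_pow_commute[OF comm, of k] that
      by (simp add: matrix_mul_assoc Suc_diff_le)
    have "mat_pow (A + B) (Suc n) = (\<Sum>k\<le>n. real (n choose k) *\<^sub>R ?t (Suc n) (Suc k))
        + (\<Sum>k\<le>n. real (n choose k) *\<^sub>R ?t (Suc n) k)"
      by (simp add: Suc.IH linear_add[OF linear_mult_right] linear_sum[OF linear_mult_left] B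
          matrix_mul_assoc scaleR_add_right sum.distrib)
    \<comment> \<open>The added term for \<open>Suc n\<close> vanishes because
      \<open>n choose Suc n\<close> is 0. After the shift both sums run over \<open>Suc k\<close>,
      and Pascal's rule merges them.\<close>
    also have "(\<Sum>k\<le>n. real (n choose k) *\<^sub>R ?t (Suc n) k)
        = (\<Sum>k\<le>Suc n. real (n choose k) *\<^sub>R ?t (Suc n) k)"
      by simp
    also have "\<dots> = ?t (Suc n) 0 + (\<Sum>k\<le>n. real (n choose Suc k) *\<^sub>R ?t (Suc n) (Suc k))"
      by (subst sum.atMost_Suc_shift) simp
    finally show ?case
      by (subst sum.atMost_Suc_shift) (simp add: scaleR_add_left sum.distrib add_ac)
  qed simp
  then show ?thesis
    by (simp add: scaleR_sum_right binomial_fact field_simps)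
qed

text \<open>The Cauchy product theorem is applied to the scalar series of single entries. Summing
  over the inner matrix index \<open>m\<close> and swapping the two finite sums turns the
  convolution into the binomial expansion.\<close>

lemma mat_exp_add_commuting:
  assumes "A ** B = B ** A"
  shows "mat_exp (A + B) = mat_exp A ** mat_exp B"
proof -
  let ?a = "\<lambda>k. mat_pow A k /\<^sub>R fact k" and ?b = "\<lambda>k. mat_pow B k /\<^sub>R fact k"
  have "mat_exp (A + B) $ i $ j = (mat_exp A ** mat_exp B) $ i $ j" for i j
  proof (rule sums_unique2)
    have "(\<lambda>n. \<Sum>k\<le>n. ?a k $ i $ m * ?b (n - k) $ m $ j) sums (mat_exp A $ i $ m * mat_exp B $ m $ j)" for m
      using Cauchy_product_sums[OF summable_norm_mat_exp_entry[of A i m]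
          summable_norm_mat_exp_entry[of B m j]]
      by (simp only: sums_unique[OF mat_exp_entry_sums, symmetric])
    then have "(\<lambda>n. \<Sum>m\<in>UNIV. \<Sum>k\<le>n. ?a k $ i $ m * ?b (n - k) $ m $ j)
        sums (\<Sum>m\<in>UNIV. mat_exp A $ i $ m * mat_exp B $ m $ j)"
      by (intro sums_sum)
    moreover have "(\<Sum>m\<in>UNIV. \<Sum>k\<le>n. ?a k $ i $ m * ?b (n - k) $ m $ j)
        = (mat_pow (A + B) n /\<^sub>R fact n) $ i $ j" for n
      unfolding mat_pow_add_commuting[OF assms]
      by (subst sum.swap) (simp add: matrix_matrix_mult_def)
    ultimately show "(\<lambda>n. (mat_pow (A + B) n /\<^sub>R fact n) $ i $ j) sums (mat_exp A ** mat_exp B) $ i $ j"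
      by (simp add: matrix_matrix_mult_def)
  qed (rule mat_exp_entry_sums)
  then show ?thesis
    by (simp add: vec_eq_iff)
qed

section \<open>Unitary evolution generated by Hermitian matrices\<close>

lemma dagger_mat_exp_hermitian:
  assumes "hermitian A"
  shows "dagger (mat_exp (cscale (- \<i> * of_real t) A)) = mat_exp (cscale (\<i> * of_real t) A)"
  using assms by (simp add: dagger_mat_exp dagger_cscale hermitian_def)

lemma unitary_mat_exp:
  assumes "hermitian A"
  shows "unitary (mat_exp (cscale (- \<i> * of_real t) A))"
proof -
  have "mat_exp (cscale a A) ** mat_exp (cscale b A) = mat 1" if "a + b = 0" for a b
    using mat_exp_add_commuting[of "cscale a A" "cscale b A"] that
    by (simp add: cscale_mult_left cscale_mult_right mult.commute mat_exp_zero
        flip: cscale_add_left)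
  then show ?thesis
    unfolding unitary_def dagger_mat_exp_hermitian[OF assms] by simp
qed

lemma mat_exp_tensor_sum:
  fixes A :: "'l::finite cmat" and F :: "'e::finite cmat"
  shows "mat_exp (cscale s (A \<otimes> (mat 1 :: 'w::finite cmat) \<otimes> mat 1 + mat 1 \<otimes> mat 1 \<otimes> F))
    = mat_exp (cscale s A) \<otimes> mat 1 \<otimes> mat_exp (cscale s F)"
proof -
  \<comment> \<open>The identities on wall and environment are merged into one, so that the rules
    for a single identity factor apply. The two summands commute because they act on different
    tensor factors.\<close>
  let ?A = "cscale s A \<otimes> (mat 1 :: ('w \<times> 'e) cmat)"
  let ?F = "(mat 1 :: 'l cmat) \<otimes> (mat 1 :: 'w cmat) \<otimes> cscale s F"
  have "cscale s (A \<otimes> (mat 1 :: 'w cmat) \<otimes> mat 1 + mat 1 \<otimes> mat 1 \<otimes> F) = ?A + ?F"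
    by (simp add: cscale_add cscale_tensor_op_left cscale_tensor_op_right)
  also have "mat_exp \<dots> = mat_exp ?A ** mat_exp ?F"
    by (rule mat_exp_add_commuting) (simp add: tensor_op_mult)
  finally show ?thesis
    by (simp add: mat_exp_tensor_op_mat_1 mat_exp_mat_1_tensor_op tensor_op_mult)
qed

subsection \<open>Eigenstate projections\<close>

lemma hermitian_ketbra: "hermitian (ketbra w)"
  by (simp add: hermitian_def dagger_def ketbra_def vec_eq_iff mult.commute)

lemma sum_mult_cnj_eq_1:
  fixes w :: "complex ^ 'n::finite"
  assumes "norm w = 1"
  shows "(\<Sum>i\<in>UNIV. w $ i * cnj (w $ i)) = 1"
proof -
  have "(\<Sum>i\<in>UNIV. (norm (w $ i))\<^sup>2) = 1"
    using assms by (simp add: norm_vec_def L2_set_def)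
  then show ?thesis
    by (simp add: complex_norm_square[symmetric] flip: of_real_power of_real_sum)
qed

lemma trace_ketbra: "norm w = 1 \<Longrightarrow> trace (ketbra w) = 1"
  by (simp add: trace_def ketbra_def sum_mult_cnj_eq_1)

lemma ketbra_idem: "norm w = 1 \<Longrightarrow> ketbra w ** ketbra w = ketbra w"
proof -
  assume "norm w = 1"
  then have "(\<Sum>k\<in>UNIV. w $ i * cnj (w $ k) * (w $ k * cnj (w $ j))) = w $ i * cnj (w $ j)" for i j
    using arg_cong[OF sum_mult_cnj_eq_1[of w], of "\<lambda>s. w $ i * cnj (w $ j) * s"]
    by (simp add: sum_distrib_left mult_ac)
  then show ?thesis
    by (simp add: ketbra_def vec_eq_iff matrix_matrix_mult_def)
qed

text \<open>The eigenvector equation is recast as an operator equation. The eigenvalue is real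
  because compressing the Hermitian \<open>A\<close> by \<open>ketbra w\<close> on both sides gives
  a Hermitian matrix, namely \<open>cscale c (ketbra w)\<close>.\<close>

lemma hermitian_eigenstate_ketbra:
  assumes herm: "hermitian A" and "eigenstate A w"
  obtains c where "c \<in> \<real>" "A ** ketbra w = cscale c (ketbra w)"
proof -
  obtain c where w: "norm w = 1" and c: "A *v w = c *s w"
    using assms by (auto simp: eigenstate_def)
  have "(\<Sum>k\<in>UNIV. A $ i $ k * w $ k) = c * w $ i" for i
    using arg_cong[OF c, of "\<lambda>v. v $ i"] by (simp add: matrix_vector_mult_def)
  then have eq: "A ** ketbra w = cscale c (ketbra w)"
    by (simp add: ketbra_def cscale_def vec_eq_iff matrix_matrix_mult_def
        flip: mult.assoc sum_distrib_right)
  have K: "ketbra w ** A ** ketbra w = cscale c (ketbra w)"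
    by (simp add: cscale_mult_right ketbra_idem[OF w] eq flip: matrix_mul_assoc)
  have "dagger (ketbra w ** A ** ketbra w) = ketbra w ** A ** ketbra w"
    using herm hermitian_ketbra[of w] by (simp add: dagger_mult hermitian_def matrix_mul_assoc)
  then have "cscale c (ketbra w) = cscale (cnj c) (ketbra w)"
    using hermitian_ketbra[of w] by (simp add: K dagger_cscale hermitian_def)
  \<comment> \<open>Since \<open>ketbra w\<close> has trace 1, the trace recovers the scalar and
    forces \<open>c = cnj c\<close>.\<close>
  moreover have "trace (cscale a (ketbra w)) = a" for a
    using trace_ketbra[OF w] by (simp add: trace_def cscale_def flip: sum_distrib_left)
  ultimately have "c = cnj c"
    by metis
  then show thesis
    using that eq by (metis Reals_cnj_iff)
qed

theorem proposition1:
  fixes H :: "('l::finite \<times> 'w::finite \<times> 'e::finite) cmat"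
    and w :: "complex ^ 'w"
  assumes "hermitian H"
    and "\<exists>(HL :: 'l cmat) (HW :: 'w cmat) (HE :: 'e cmat) (m :: nat) (n :: nat)
          (B :: nat \<Rightarrow> 'l cmat) (C :: nat \<Rightarrow> 'w cmat)
          (D :: nat \<Rightarrow> 'w cmat) (E :: nat \<Rightarrow> 'e cmat).
        hermitian HL \<and> hermitian HW \<and> hermitian HE \<and>
        (\<forall>j<m. hermitian (B j) \<and> hermitian (C j)) \<and>
        (\<forall>j<n. hermitian (D j) \<and> hermitian (E j)) \<and>
        H = (HL \<otimes> mat 1 \<otimes> mat 1) + (mat 1 \<otimes> HW \<otimes> mat 1) + (mat 1 \<otimes> mat 1 \<otimes> HE)
            + (\<Sum>j<m. B j \<otimes> C j \<otimes> mat 1) + (\<Sum>j<n. mat 1 \<otimes> D j \<otimes> E j) \<and>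
        eigenstate HW w \<and> (\<forall>j<m. eigenstate (C j) w) \<and> (\<forall>j<n. eigenstate (D j) w)"
  shows "perfect_wall_state H w"
proof -
  obtain HL :: "'l cmat" and HW :: "'w cmat" and HE :: "'e cmat" and m n :: nat
    and B :: "nat \<Rightarrow> 'l cmat" and C D :: "nat \<Rightarrow> 'w cmat" and E :: "nat \<Rightarrow> 'e cmat"
    where herm: "hermitian HL" "hermitian HW" "hermitian HE"
      "\<forall>j<m. hermitian (B j) \<and> hermitian (C j)" "\<forall>j<n. hermitian (D j) \<and> hermitian (E j)"
      and H: "H = (HL \<otimes> mat 1 \<otimes> mat 1) + (mat 1 \<otimes> HW \<otimes> mat 1) + (mat 1 \<otimes> mat 1 \<otimes> HE)
            + (\<Sum>j<m. B j \<otimes> C j \<otimes> mat 1) + (\<Sum>j<n. mat 1 \<otimes> D j \<otimes> E j)"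
      and eig: "eigenstate HW w" "\<forall>j<m. eigenstate (C j) w" "\<forall>j<n. eigenstate (D j) w"
    using assms(2) by blast
  have w: "norm w = 1"
    using eig(1) by (simp add: eigenstate_def)
  obtain h where h: "h \<in> \<real>" "HW ** ketbra w = cscale h (ketbra w)"
    using hermitian_eigenstate_ketbra herm(2) eig(1) by blast
  have "\<forall>j. \<exists>c. j < m \<longrightarrow> c \<in> \<real> \<and> C j ** ketbra w = cscale c (ketbra w)"
    using hermitian_eigenstate_ketbra herm(4) eig(2) by metis
  then obtain c where c: "\<And>j. j < m \<Longrightarrow> c j \<in> \<real>"
    "\<And>j. j < m \<Longrightarrow> C j ** ketbra w = cscale (c j) (ketbra w)"
    by metis
  have "\<forall>j. \<exists>d. j < n \<longrightarrow> d \<in> \<real> \<and> D j ** ketbra w = cscale d (ketbra w)"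
    using hermitian_eigenstate_ketbra herm(5) eig(3) by metis
  then obtain d where d: "\<And>j. j < n \<Longrightarrow> d j \<in> \<real>"
    "\<And>j. j < n \<Longrightarrow> D j ** ketbra w = cscale (d j) (ketbra w)"
    by metis
  \<comment> \<open>\<open>A\<close> collects the logical terms with each \<open>C j\<close>
    replaced by its eigenvalue, \<open>F\<close> the environment terms with each \<open>D j\<close>
    replaced. The wall energy \<open>h\<close> is a multiple of the identity, a global phase in the
    evolution, and is assigned to \<open>F\<close>.\<close>
  define A where "A = HL + (\<Sum>j<m. cscale (c j) (B j))"
  define F where "F = cscale h (mat 1) + HE + (\<Sum>j<n. cscale (d j) (E j))"
  define G :: "('l \<times> 'w \<times> 'e) cmat" where "G = A \<otimes> mat 1 \<otimes> mat 1 + mat 1 \<otimes> mat 1 \<otimes> F"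
  define P :: "('l \<times> 'w \<times> 'e) cmat" where "P = mat 1 \<otimes> ketbra w \<otimes> mat 1"
  \<comment> \<open>The reality of the eigenvalues enters here.\<close>
  have hA: "hermitian A" and hF: "hermitian F"
    unfolding A_def F_def using herm h(1) c(1) d(1)
    by (auto intro!: hermitian_add hermitian_sum hermitian_cscale_real hermitian_mat_1)
  have hG: "hermitian G" and hP: "hermitian P"
    unfolding G_def P_def
    by (intro hermitian_add hermitian_tensor_op hermitian_mat_1 hermitian_ketbra hA hF)+
  have "H ** P = HL \<otimes> ketbra w \<otimes> mat 1 + mat 1 \<otimes> cscale h (ketbra w) \<otimes> mat 1 + mat 1 \<otimes> ketbra w \<otimes> HE
      + (\<Sum>j<m. B j \<otimes> cscale (c j) (ketbra w) \<otimes> mat 1)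
      + (\<Sum>j<n. mat 1 \<otimes> cscale (d j) (ketbra w) \<otimes> E j)"
    unfolding H P_def
    by (simp add: linear_add[OF linear_mult_right] linear_sum[OF linear_mult_right] tensor_op_mult h(2) c(2) d(2)
        del: tensor_op_mat_1)
  also have "\<dots> = A \<otimes> ketbra w \<otimes> mat 1 + mat 1 \<otimes> ketbra w \<otimes> F"
    unfolding A_def F_def
    by (simp add: tensor_op_add_left tensor_op_add_right linear_sum[OF linear_tensor_op_left]
        linear_sum[OF linear_tensor_op_right] cscale_tensor_op_left cscale_tensor_op_right add_ac)
  also have "\<dots> = G ** P"
    unfolding G_def P_def by (simp add: linear_add[OF linear_mult_right] tensor_op_mult del: tensor_op_mat_1)
  finally have HP: "H ** P = G ** P" .
  \<comment> \<open>Both summands of \<open>G\<close> act as the identity on the wall, the only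
    factor on which \<open>P\<close> is not the identity.\<close>
  have GP: "G ** P = P ** G"
    unfolding G_def P_def
    by (simp add: linear_add[OF linear_mult_right] linear_add[OF linear_mult_left] tensor_op_mult del: tensor_op_mat_1)
  have expP: "mat_exp (cscale s H) ** P = mat_exp (cscale s G) ** P" for s
    by (rule mat_exp_mult_eq) (simp_all add: cscale_mult_left cscale_mult_right HP GP)
  \<comment> \<open>This is the adjoint of \<open>expP\<close> at the opposite time sign;
    \<open>H\<close>, \<open>G\<close> and \<open>P\<close> are Hermitian.\<close>
  have Pexp: "P ** mat_exp (cscale (\<i> * of_real t) H) = P ** mat_exp (cscale (\<i> * of_real t) G)" for t
    using arg_cong[OF expP[of "- \<i> * of_real t"], of dagger] hP
    unfolding dagger_mult dagger_mat_exp_hermitian[OF assms(1)] dagger_mat_exp_hermitian[OF hG]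
    by (simp add: hermitian_def)
  have "reduced_state H w \<rho>e \<rho>l t = mat_exp (cscale (- \<i> * of_real t) A) ** \<rho>l
      ** dagger (mat_exp (cscale (- \<i> * of_real t) A))"
    if "density_matrix \<rho>e" for \<rho>e \<rho>l t
  proof -
    let ?U = "mat_exp (cscale (- \<i> * of_real t) A)" and ?V = "mat_exp (cscale (- \<i> * of_real t) F)"
    let ?R = "\<rho>l \<otimes> ketbra w \<otimes> \<rho>e"
    let ?m = "- \<i> * of_real t" and ?p = "\<i> * of_real t"
    \<comment> \<open>Idempotence of \<open>ketbra w\<close> supplies a copy of \<open>P\<close> on
      each side of the state, next to the exponentials of \<open>H\<close>, which can then be
      exchanged for those of \<open>G\<close>.\<close>
    have R: "?R = P ** ?R ** P"
      unfolding P_def by (simp add: tensor_op_mult ketbra_idem[OF w] del: tensor_op_mat_1)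
    have "mat_exp (cscale ?m H) ** ?R ** mat_exp (cscale ?p H)
        = (mat_exp (cscale ?m H) ** P) ** ?R ** (P ** mat_exp (cscale ?p H))"
      by (subst R) (simp only: matrix_mul_assoc)
    also have "\<dots> = mat_exp (cscale ?m G) ** (P ** ?R ** P) ** mat_exp (cscale ?p G)"
      unfolding expP Pexp by (simp only: matrix_mul_assoc)
    also have "\<dots> = mat_exp (cscale ?m G) ** ?R ** mat_exp (cscale ?p G)"
      by (simp only: R[symmetric])
    also have "\<dots> = (?U ** \<rho>l ** dagger ?U) \<otimes> ketbra w \<otimes> (?V ** \<rho>e ** dagger ?V)"
      unfolding G_def mat_exp_tensor_sum dagger_mat_exp_hermitian[OF hA] dagger_mat_exp_hermitian[OF hF]
      by (simp only: tensor_op_mult matrix_mul_lid matrix_mul_rid)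
    finally have red: "reduced_state H w \<rho>e \<rho>l t
        = cscale (trace (?V ** \<rho>e ** dagger ?V)) (?U ** \<rho>l ** dagger ?U)"
      by (simp add: reduced_state_def partial_trace_snd_tensor_op trace_tensor_op trace_ketbra[OF w])
    \<comment> \<open>Tracing out wall and environment leaves only the trace of the evolved
      environment state as a scalar; cyclicity of the trace and unitarity of \<open>?V\<close> make
      it 1.\<close>
    have "trace (?V ** \<rho>e ** dagger ?V) = trace ((dagger ?V ** ?V) ** \<rho>e)"
      by (subst trace_mul_sym) (simp only: matrix_mul_assoc)
    also have "\<dots> = 1"
      using unitary_mat_exp[OF hF, of t] that by (simp add: unitary_def density_matrix_def)
    finally show ?thesis
      using red by simp
  qed
  \<comment> \<open>The witness is the evolution generated by \<open>A\<close> alone, so one family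
    of unitaries serves every environment state.\<close>
  then show ?thesis
    unfolding perfect_wall_state_def using w unitary_mat_exp[OF hA]
    by (auto intro!: exI[of _ "\<lambda>t. mat_exp (cscale (- \<i> * of_real t) A)"])
qed

end
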